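(* Let $X$ be a reflexive real Banach space, $N\ge1$, and let $f_1,\dots,f_N\colon X\to\mathbb{R}$ be U-functions. Let $\phi\colon\Sigma_N\to X$ be the map $\phi(t)=\operatorname{argmin}\left(\sum_{i=1}^N t_i f_i\right)$. Then the following assertions hold. (i) If $f_i$ has the small diameter property (SDP) for some $i\in\{1,\dots,N\}$, then $\phi$ is continuous on $\{t=(t_1,\dots,t_N)\in\Sigma_N: t_i\neq0\}$. (ii) If $f_i$ has the SDP for every $i=1,\dots,N$, then $\phi$ is continuous on $\Sigma_N$.
   Context: $X^*$ is the topological dual of $X$; $X$ carries its norm topology. $\Sigma_N=\{t\in[0,1]^N:\sum_{i=1}^N t_i=1\}$ carries the topology induced from $\mathbb{R}^N$. In (i), "continuous on" the set means continuous at each of its points as a map on $\Sigma_N$. A function $f\colon X\to\mathbb{R}$ is strictly convex if $f\left(\frac{x+y}{2}\right)<\frac12(f(x)+f(y))$ for all $x\ne y$ in $X$. A function $f\colon X\to\mathbb{R}$ on a reflexive Banach space is a U-function if (a) $f$ is continuous, convex and strictly convex, and bounded on bounded sets; and (b) $f$ is coercive, i.e. for each $C\in\mathbb{R}$ the set $\{x\in X: f(x)\le C\}$ is bounded. Each U-function $f$ has a unique minimum point, denoted $\operatorname{argmin}(f)$; convex combinations of U-functions are U-functions. Small diameter property: for a convex continuous $f\colon X\to\mathbb{R}$, $x\in X$ and $x^*$ in the subdifferential $\partial f(x)=\{x^*\in X^*: x^*(y-x)\le f(y)-f(x)\ \forall y\in X\}$, the point $x$ is an $x^*$-small diameter point for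 $f$ if every sequence $\{x_n\}\subset X$ with $x^*(x_n)-f(x_n)\to x^*(x)-f(x)$ is norm convergent. $f$ has the SDP if, for every $x\in X$ and every $x^*\in\partial f(x)$, $x$ is an $x^*$-small diameter point for $f$. *)

theory Defs
  imports "HOL-Analysis.Analysis"
begin

(* The canonical embedding of the space into its bidual is onto. *)
definition reflexive_space :: "'a::real_normed_vector itself \<Rightarrow> bool" where
  "reflexive_space _ \<longleftrightarrow>
     (\<forall>\<Phi> :: ('a \<Rightarrow>\<^sub>L real) \<Rightarrow>\<^sub>L real. \<exists>x::'a. \<forall>\<xi>. blinfun_apply \<Phi> \<xi> = blinfun_apply \<xi> x)"

definition strictly_convex :: "('a::real_vector \<Rightarrow> real) \<Rightarrow> bool" where
  "strictly_convex f \<longleftrightarrow> (\<forall>x y. x \<noteq> y \<longrightarrow> f ((1/2) *\<^sub>R (x + y)) < (1/2) * (f x + f y))"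

definition coercive :: "('a::real_normed_vector \<Rightarrow> real) \<Rightarrow> bool" where
  "coercive f \<longleftrightarrow> (\<forall>C. bounded {x. f x \<le> C})"

(* Reflexivity and completeness of the space are not part of this predicate;
   they are assumed where it is used. *)
definition U_function :: "('a::real_normed_vector \<Rightarrow> real) \<Rightarrow> bool" where
  "U_function f \<longleftrightarrow>
     continuous_on UNIV f \<and> convex_on UNIV f \<and> strictly_convex f \<and>
     (\<forall>B. bounded B \<longrightarrow> bounded (f ` B)) \<and> coercive f"

definition subdifferential :: "('a::real_normed_vector \<Rightarrow> real) \<Rightarrow> 'a \<Rightarrow> ('a \<Rightarrow>\<^sub>L real) set" where
  "subdifferential f x = {\<xi>. \<forall>y. blinfun_apply \<xi> (y - x) \<le> f y - f x}"

definition small_diameter_point ::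
    "('a::real_normed_vector \<Rightarrow> real) \<Rightarrow> ('a \<Rightarrow>\<^sub>L real) \<Rightarrow> 'a \<Rightarrow> bool" where
  "small_diameter_point f \<xi> x \<longleftrightarrow>
     (\<forall>s :: nat \<Rightarrow> 'a.
        (\<lambda>n. blinfun_apply \<xi> (s n) - f (s n)) \<longlonglongrightarrow> blinfun_apply \<xi> x - f x \<longrightarrow> convergent s)"

(* Meant for convex continuous f. *)
definition has_SDP :: "('a::real_normed_vector \<Rightarrow> real) \<Rightarrow> bool" where
  "has_SDP f \<longleftrightarrow> (\<forall>x. \<forall>\<xi>\<in>subdifferential f x. small_diameter_point f \<xi> x)"

definition weight_simplex :: "(real ^ 'n::finite) set" where
  "weight_simplex = {t. (\<forall>i. t $ i \<in> {0..1}) \<and> (\<Sum>i\<in>UNIV. t $ i) = 1}"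

(* Only values on weight_simplex matter. There the weighted sum of U-functions on a
   reflexive Banach space is a U-function, so its minimum point exists and is unique and
   arg_min involves no actual choice. *)
definition argmin_map ::
    "('n::finite \<Rightarrow> 'a::real_normed_vector \<Rightarrow> real) \<Rightarrow> real ^ 'n \<Rightarrow> 'a" where
  "argmin_map f t = arg_min (\<lambda>x. \<Sum>i\<in>UNIV. t $ i * f i x) (\<lambda>_. True)"

end

theory Submission imports Defs begin

text \<open>
Let \<open>\<tau> n \<longlonglongrightarrow> t\<close> in the simplex, where \<open>t $ i > 0\<close> and \<open>f i\<close> has the small diameter property;
write \<open>g\<close> for the combination with weights \<open>t\<close>, \<open>x\<close> for its minimiser and \<open>s n\<close> for the
minimiser at \<open>\<tau> n\<close>. The weight of \<open>f i\<close> stays away from 0 along the sequence, so coercivity of this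
single summand confines almost all \<open>s n\<close> to a bounded set. There the combinations with weights
\<open>\<tau> n\<close> converge uniformly to \<open>g\<close>, and hence \<open>s\<close> is a minimising sequence for \<open>g\<close>
(\<open>argmin_map_minimizing\<close>).

Next, a minimising sequence for \<open>g\<close> converges in norm (\<open>minimizing_sequence_converges\<close>). Split
\<open>g\<close> into the summand \<open>t $ i * f i\<close> and the rest. At the minimiser these have opposite
subgradients \<open>\<xi>\<close> and \<open>- \<xi>\<close>. Both parts lie above their affine supports and the supports cancel,
so \<open>g (s n) \<longlonglongrightarrow> g x\<close> forces the excess of \<open>f i\<close> over its own support to vanish. This is the hypothesis
of the small diameter property, which yields a norm limit; strict convexity identifies the limit
with \<open>x\<close>. The second assertion follows because every point of the simplex has a positive weight.

Subgradients come from a Hahn-Banach theorem for convex functions (\<open>linear_minorant\<close>): a minimal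
element among the convex minorants vanishing at the origin is linear. Its two-function version
\<open>linear_sandwich\<close> gives the opposite subgradients. The same theorem, applied on the dual space to an
upper limit along a bounded sequence, produces an element of the bidual; by reflexivity this is
a point of the space that serves as a weak cluster point (\<open>reflexive_bounded_sequence\<close>). Minimisers
exist because a subgradient at that point makes the function weakly lower semicontinuous there.
\<close>

section \<open>Linear minorants of convex functions\<close>

text \<open>
The condition \<open>join\<close> covers in one stroke the infimum over a chain, the partial minimisation
of a jointly convex function, and the limit of a decreasing sequence of suprema.
\<close>

lemma convex_on_INF:
  fixes \<phi> :: "'i \<Rightarrow> 'a::real_vector \<Rightarrow> real"
  assumes "I \<noteq> {}"
    and bdd: "\<And>u. bdd_below ((\<lambda>i. \<phi> i u) ` I)"
    and join: "\<And>i j u v a b. i \<in> I \<Longrightarrow> j \<in> I \<Longrightarrow> 0 \<le> a \<Longrightarrow> 0 \<le> b \<Longrightarrow> a + b = 1 \<Longrightarrow>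
      \<exists>k\<in>I. \<phi> k (a *\<^sub>R u + b *\<^sub>R v) \<le> a * \<phi> i u + b * \<phi> j v"
  shows "convex_on UNIV (\<lambda>u. INF i\<in>I. \<phi> i u)"
proof -
  have "(INF i\<in>I. \<phi> i (a *\<^sub>R u + b *\<^sub>R v)) \<le> a * (INF i\<in>I. \<phi> i u) + b * (INF i\<in>I. \<phi> i v)"
    if ab: "0 \<le> a" "0 \<le> b" "a + b = 1" for u v a b
  proof (rule field_le_epsilon)
    fix e :: real
    assume "0 < e"
    then obtain i j where i: "i \<in> I" "\<phi> i u < (INF i\<in>I. \<phi> i u) + e"
      and j: "j \<in> I" "\<phi> j v < (INF i\<in>I. \<phi> i v) + e"
      using cINF_less_iff[OF assms(1) bdd] by (metis less_add_same_cancel1)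
    obtain k where k: "k \<in> I" "\<phi> k (a *\<^sub>R u + b *\<^sub>R v) \<le> a * \<phi> i u + b * \<phi> j v"
      using join[OF i(1) j(1) ab] by blast
    have "(INF i\<in>I. \<phi> i (a *\<^sub>R u + b *\<^sub>R v)) \<le> \<phi> k (a *\<^sub>R u + b *\<^sub>R v)"
      by (rule cINF_lower[OF bdd k(1)])
    also have "\<dots> \<le> a * ((INF i\<in>I. \<phi> i u) + e) + b * ((INF i\<in>I. \<phi> i v) + e)"
      using k(2) i(2) j(2) ab
      by (meson add_mono less_imp_le mult_left_mono order_trans)
    also have "\<dots> = a * (INF i\<in>I. \<phi> i u) + b * (INF i\<in>I. \<phi> i v) + (a + b) * e"
      by (simp add: algebra_simps)
    finally show "(INF i\<in>I. \<phi> i (a *\<^sub>R u + b *\<^sub>R v))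
        \<le> a * (INF i\<in>I. \<phi> i u) + b * (INF i\<in>I. \<phi> i v) + e"
      using ab by simp
  qed
  then show ?thesis
    by (auto simp: convex_on_def)
qed

lemma convex_on_combination:
  assumes "convex_on UNIV h" "0 \<le> a" "0 \<le> b" "a + b = (1::real)"
  shows "h (a *\<^sub>R u + b *\<^sub>R v) \<le> a * h u + b * h v"
  using assms by (auto simp: convex_on_def)

lemma convex_zero_ge_reflection:
  fixes h :: "'a::real_vector \<Rightarrow> real"
  assumes "convex_on UNIV h" "h 0 = 0"
  shows "- h (- v) \<le> h v"
  using convex_on_combination[OF assms(1), of "1/2" "1/2" v "- v"] assms(2) by simp

text \<open>
Zorn's lemma applies because convexity and the value 0 at the origin bound every convex minorant
\<open>h\<close> from below by \<open>- f (- v)\<close>, so that the pointwise infimum of a chain is again such a function.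
\<close>

lemma minimal_convex_minorant:
  fixes f :: "'a::real_vector \<Rightarrow> real"
  assumes f: "convex_on UNIV f" "f 0 = 0"
  obtains h where "convex_on UNIV h" "h 0 = 0" "h \<le> f"
    "\<And>k. convex_on UNIV k \<Longrightarrow> k 0 = 0 \<Longrightarrow> k \<le> h \<Longrightarrow> k = h"
proof -
  define A where "A = {h. convex_on UNIV h \<and> h 0 = 0 \<and> h \<le> f}"
  have "partial_order_on A (relation_of (\<ge>) A)"
    by (rule partial_order_on_relation_ofI) auto
  moreover have "\<exists>u\<in>A. \<forall>a\<in>C. u \<le> a" if "C \<in> Chains (relation_of (\<ge>) A)" for C
  proof (cases "C = {}")
    case True
    then show ?thesis using f by (auto simp: A_def)
  next
    case False
    have CA: "C \<subseteq> A"
      using that Chains_relation_of by blast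
    have chain: "h \<le> k \<or> k \<le> h" if "h \<in> C" "k \<in> C" for h k
      using that \<open>C \<in> Chains _\<close> by (auto simp: Chains_def relation_of_def)
    have low: "- f (- v) \<le> h v" if "h \<in> C" for h v
      using convex_zero_ge_reflection[of h v] that CA le_funD[of h f "- v"]
      by (auto simp: A_def)
    have bdd: "bdd_below ((\<lambda>h. h v) ` C)" for v
      using low by (auto simp: bdd_below_def)
    have "convex_on UNIV (\<lambda>v. INF h\<in>C. h v)"
    proof (rule convex_on_INF[OF False bdd])
      fix h k u v and a b :: real
      assume hk: "h \<in> C" "k \<in> C" and ab: "0 \<le> a" "0 \<le> b" "a + b = 1"
      obtain l where l: "l \<in> C" "l \<le> h" "l \<le> k"
        using chain[OF hk] hk by auto
      have "l (a *\<^sub>R u + b *\<^sub>R v) \<le> a * l u + b * l v"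
        using l CA ab by (intro convex_on_combination) (auto simp: A_def)
      also have "\<dots> \<le> a * h u + b * k v"
        using l ab by (intro add_mono mult_left_mono) (auto simp: le_funD)
      finally show "\<exists>l\<in>C. l (a *\<^sub>R u + b *\<^sub>R v) \<le> a * h u + b * k v"
        using l by blast
    qed
    moreover have "(INF h\<in>C. h 0) = 0"
    proof -
      have "(\<lambda>h. h 0) ` C = {0}"
        using CA False by (auto simp: A_def)
      then show ?thesis by simp
    qed
    moreover have lower: "(\<lambda>v. INF h\<in>C. h v) \<le> h" if "h \<in> C" for h
      using cINF_lower[OF bdd that] by (simp add: le_fun_def)
    moreover have "(\<lambda>v. INF h\<in>C. h v) \<le> f"
    proof -
      obtain h where "h \<in> C" using False by blast
      then show ?thesis
        using lower[of h] CA unfolding A_def by (blast intro: order_trans)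
    qed
    ultimately show ?thesis
      by (intro bexI[of _ "\<lambda>v. INF h\<in>C. h v"]) (auto simp: A_def)
  qed
  ultimately obtain h where "h \<in> A" and minimal: "\<And>k. k \<in> A \<Longrightarrow> k \<le> h \<Longrightarrow> k = h"
    using predicate_Zorn[of A "(\<ge>)"] by blast
  show thesis
  proof (rule that)
    show "convex_on UNIV h" "h 0 = 0" "h \<le> f"
      using \<open>h \<in> A\<close> by (auto simp: A_def)
    fix k
    assume "convex_on UNIV k" "k 0 = 0" "k \<le> h"
    then show "k = h"
      using minimal \<open>h \<le> f\<close> by (auto simp: A_def)
  qed
qed

text \<open>
A minimal convex minorant \<open>h\<close> is linear because each failure of linearity yields a strictly
smaller one: \<open>s * h (u / s)\<close> lies below \<open>h\<close> for \<open>s \<ge> 1\<close>, so \<open>h\<close> is positively homogeneous and hence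
subadditive; and lowering \<open>h\<close> until it is affine in the direction \<open>v\<close> shows that it is superadditive.
\<close>

theorem linear_minorant:
  fixes f :: "'a::real_vector \<Rightarrow> real"
  assumes f: "convex_on UNIV f" "f 0 = 0"
  obtains l where "linear l" "\<And>v. l v \<le> f v"
proof -
  obtain h where h: "convex_on UNIV h" "h 0 = 0" "h \<le> f"
    and minimal: "\<And>k. convex_on UNIV k \<Longrightarrow> k 0 = 0 \<Longrightarrow> k \<le> h \<Longrightarrow> k = h"
    using minimal_convex_minorant[OF f] by blast
  note conv = convex_on_combination[OF h(1)]
  have scale_ge1: "s * h ((1/s) *\<^sub>R u) = h u" if "1 \<le> s" for s u
  proof -
    let ?k = "\<lambda>u. s * h ((1/s) *\<^sub>R u)"
    have "convex_on UNIV ?k"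
    proof (rule convex_onI)
      fix t :: real and x y
      assume t: "0 < t" "t < 1"
      have "h ((1/s) *\<^sub>R ((1 - t) *\<^sub>R x + t *\<^sub>R y))
          = h ((1 - t) *\<^sub>R ((1/s) *\<^sub>R x) + t *\<^sub>R ((1/s) *\<^sub>R y))"
        by (simp add: scaleR_add_right mult.commute)
      also have "\<dots> \<le> (1 - t) * h ((1/s) *\<^sub>R x) + t * h ((1/s) *\<^sub>R y)"
        using t by (intro conv) auto
      finally have "s * h ((1/s) *\<^sub>R ((1 - t) *\<^sub>R x + t *\<^sub>R y))
          \<le> s * ((1 - t) * h ((1/s) *\<^sub>R x) + t * h ((1/s) *\<^sub>R y))"
        using that by (intro mult_left_mono) auto
      then show "s * h ((1/s) *\<^sub>R ((1 - t) *\<^sub>R x + t *\<^sub>R y))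
          \<le> (1 - t) * (s * h ((1/s) *\<^sub>R x)) + t * (s * h ((1/s) *\<^sub>R y))"
        by (simp add: algebra_simps)
    qed auto
    moreover have "?k \<le> h"
    proof (rule le_funI)
      fix u
      have "h ((1/s) *\<^sub>R u + (1 - 1/s) *\<^sub>R 0) \<le> (1/s) * h u + (1 - 1/s) * h 0"
        using that by (intro conv) auto
      then show "?k u \<le> h u"
        using that h(2) by (simp add: field_simps)
    qed
    ultimately have "?k = h"
      using h(2) by (intro minimal) auto
    then show ?thesis by (rule fun_cong)
  qed
  have scale: "h (s *\<^sub>R u) = s * h u" if s: "0 \<le> s" for s u
  proof -
    consider "s = 0" | "1 \<le> s" | "0 < s" "s < 1" using s by linarith
    then show ?thesis
    proof cases
      case 1
      then show ?thesis using h(2) by simp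
    next
      case 2
      then show ?thesis using scale_ge1[of s "s *\<^sub>R u"] by simp
    next
      case 3
      then show ?thesis using scale_ge1[of "1/s" u] by (simp add: field_simps)
    qed
  qed
  have subadd: "h (u + v) \<le> h u + h v" for u v
    using conv[of "1/2" "1/2" u v] scale[of 2 "(1/2) *\<^sub>R u + (1/2) *\<^sub>R v"]
    by (simp add: scaleR_add_right)
  have superadd: "h u + h v \<le> h (u + v)" for u v
  proof -
    \<comment> \<open>The infimum is below \<open>h\<close> by \<open>t = 0\<close>, and \<open>t = 1\<close> gives the inequality sought.\<close>
    let ?\<psi> = "\<lambda>t u. h (u + t *\<^sub>R v) - t * h v"
    let ?k = "\<lambda>u. INF t\<in>{0..}. ?\<psi> t u"
    have low: "- h (- u) \<le> ?\<psi> t u" if "0 \<le> t" for t u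
      using subadd[of "u + t *\<^sub>R v" "- u"] scale[OF that, of v] by simp
    have bdd: "bdd_below ((\<lambda>t. ?\<psi> t u) ` {0..})" for u
      using low by (auto simp: bdd_below_def)
    have "convex_on UNIV ?k"
    proof (rule convex_on_INF[OF _ bdd])
      fix s t a b :: real and x y
      assume st: "s \<in> {0..}" "t \<in> {0..}" and ab: "0 \<le> a" "0 \<le> b" "a + b = 1"
      have "h (a *\<^sub>R (x + s *\<^sub>R v) + b *\<^sub>R (y + t *\<^sub>R v))
          \<le> a * h (x + s *\<^sub>R v) + b * h (y + t *\<^sub>R v)"
        by (rule conv[OF ab])
      moreover have "a *\<^sub>R (x + s *\<^sub>R v) + b *\<^sub>R (y + t *\<^sub>R v)
          = (a *\<^sub>R x + b *\<^sub>R y) + (a * s + b * t) *\<^sub>R v"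
        by (simp add: algebra_simps)
      ultimately have "?\<psi> (a * s + b * t) (a *\<^sub>R x + b *\<^sub>R y) \<le> a * ?\<psi> s x + b * ?\<psi> t y"
        by (simp add: algebra_simps)
      then show "\<exists>r\<in>{0..}. ?\<psi> r (a *\<^sub>R x + b *\<^sub>R y) \<le> a * ?\<psi> s x + b * ?\<psi> t y"
        using st ab by (intro bexI[of _ "a * s + b * t"]) auto
    qed auto
    moreover have "?k 0 = 0"
    proof -
      have "(\<lambda>t. ?\<psi> t 0) ` {0..} = {0}"
        using scale by auto
      then show ?thesis by simp
    qed
    moreover have "?k \<le> h"
      using cINF_lower[OF bdd, of 0] by (auto simp: le_fun_def)
    ultimately have "?k = h"
      by (rule minimal)
    then have "h u = ?k u" by (rule fun_cong[OF sym])
    also have "\<dots> \<le> h (u + v) - h v"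
      using cINF_lower[OF bdd, of 1 u] by simp
    finally show ?thesis by simp
  qed
  have add: "h (u + v) = h u + h v" for u v
    using subadd superadd by (rule antisym)
  have "h (r *\<^sub>R u) = r *\<^sub>R h u" for r u
  proof (cases "0 \<le> r")
    case False
    then show ?thesis
      using add[of "r *\<^sub>R u" "(- r) *\<^sub>R u"] scale[of "- r" u] h(2) by simp
  qed (simp add: scale)
  with add have "linear h"
    by (intro linearI) auto
  then show thesis
    using that h(3) by (auto simp: le_fun_def)
qed

text \<open>
The infimal convolution of \<open>F\<close> and the reflection of \<open>H\<close> is convex and lies below both of them, so a
linear function below it obeys both bounds at once.
\<close>

theorem linear_sandwich:
  fixes F H :: "'a::real_vector \<Rightarrow> real"
  assumes F: "convex_on UNIV F" "F 0 = 0"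
    and H: "convex_on UNIV H" "H 0 = 0"
    and nonneg: "\<And>v. 0 \<le> F v + H v"
  obtains l where "linear l" "\<And>v. l v \<le> F v" "\<And>v. - H v \<le> l v"
proof -
  let ?p = "\<lambda>v. INF w. F (v + w) + H w"
  \<comment> \<open>The midpoint of \<open>v + w\<close> and \<open>- v\<close> is that of \<open>w\<close> and 0, where \<open>F + H\<close> is nonnegative.\<close>
  have low: "- F (- v) \<le> F (v + w) + H w" for v w
  proof -
    have "F ((1/2) *\<^sub>R (v + w) + (1/2) *\<^sub>R (- v)) \<le> (1/2) * F (v + w) + (1/2) * F (- v)"
      by (rule convex_on_combination[OF F(1)]) auto
    moreover have "H ((1/2) *\<^sub>R w + (1/2) *\<^sub>R 0) \<le> (1/2) * H w + (1/2) * H 0"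
      by (rule convex_on_combination[OF H(1)]) auto
    moreover have "(1/2) *\<^sub>R (v + w) + (1/2) *\<^sub>R (- v) = (1/2) *\<^sub>R w"
      by (simp add: algebra_simps)
    ultimately show ?thesis
      using nonneg[of "(1/2) *\<^sub>R w"] H(2) by simp
  qed
  have bdd: "bdd_below (range (\<lambda>w. F (v + w) + H w))" for v
    using low[of v] by (auto simp: bdd_below_def)
  have "convex_on UNIV ?p"
  proof (rule convex_on_INF[OF _ bdd])
    fix w z u v and a b :: real
    assume ab: "0 \<le> a" "0 \<le> b" "a + b = 1"
    have "F (a *\<^sub>R (u + w) + b *\<^sub>R (v + z)) \<le> a * F (u + w) + b * F (v + z)"
      by (rule convex_on_combination[OF F(1) ab])
    moreover have "H (a *\<^sub>R w + b *\<^sub>R z) \<le> a * H w + b * H z"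
      by (rule convex_on_combination[OF H(1) ab])
    moreover have "a *\<^sub>R (u + w) + b *\<^sub>R (v + z) = (a *\<^sub>R u + b *\<^sub>R v) + (a *\<^sub>R w + b *\<^sub>R z)"
      by (simp add: algebra_simps)
    ultimately show "\<exists>r\<in>UNIV. F (a *\<^sub>R u + b *\<^sub>R v + r) + H r
        \<le> a * (F (u + w) + H w) + b * (F (v + z) + H z)"
      by (intro bexI[of _ "a *\<^sub>R w + b *\<^sub>R z"]) (auto simp: algebra_simps)
  qed auto
  moreover have le_F: "?p v \<le> F v" for v
    using cINF_lower[OF bdd, of 0 v] H(2) by simp
  moreover have le_H: "?p v \<le> H (- v)" for v
    using cINF_lower[OF bdd, of "- v" v] F(2) by simp
  moreover have "?p 0 = 0"
  proof (rule antisym)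
    show "?p 0 \<le> 0" using le_F[of 0] F(2) by simp
    show "0 \<le> ?p 0" using nonneg by (intro cINF_greatest) auto
  qed
  ultimately obtain l where l: "linear l" "\<And>v. l v \<le> ?p v"
    using linear_minorant[of ?p] by blast
  have "l v \<le> F v" for v
    using l(2) le_F order_trans by blast
  moreover have "- H v \<le> l v" for v
    using order_trans[OF l(2) le_H, of "- v"] linear_neg[OF l(1), of v] by simp
  ultimately show thesis
    using that l(1) by blast
qed

section \<open>Subgradients of continuous convex functions\<close>

text \<open>
Near the origin \<open>F\<close> is at most 1; by homogeneity this bounds \<open>l v\<close> by a multiple of the norm, and
applying the bound to \<open>- v\<close> gives the absolute value.
\<close>

lemma bounded_linear_minorant:
  fixes l F :: "'a::real_normed_vector \<Rightarrow> real"
  assumes l: "linear l" "\<And>v. l v \<le> F v"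
    and F: "isCont F 0" "F 0 = 0"
  shows "bounded_linear l"
proof -
  obtain d where d: "0 < d" "\<And>v. norm v < d \<Longrightarrow> \<bar>F v\<bar> < 1"
  proof -
    have "\<exists>d>0. \<forall>v. dist v 0 < d \<longrightarrow> dist (F v) (F 0) < 1"
      using F(1)[unfolded continuous_at_eps_delta, rule_format, of 1] by simp
    then show thesis
      using that F(2) by (auto simp: dist_norm)
  qed
  have upper: "l v \<le> norm v * (2/d)" for v
  proof (cases "v = 0")
    case True
    then show ?thesis using linear_0[OF l(1)] by simp
  next
    case False
    define c where "c = d / (2 * norm v)"
    have c: "0 < c" "norm (c *\<^sub>R v) < d"
      using False d(1) by (auto simp: c_def)
    have "c * l v = l (c *\<^sub>R v)"
      using linear_scale[OF l(1)] by simp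
    also have "\<dots> \<le> F (c *\<^sub>R v)" by (rule l(2))
    also have "\<dots> \<le> 1" using d(2)[OF c(2)] by linarith
    finally have "l v \<le> 1 / c" using c(1) by (simp add: field_simps)
    then show ?thesis by (simp add: c_def mult.commute)
  qed
  have "norm (l v) \<le> norm v * (2/d)" for v
    using upper[of v] upper[of "- v"] linear_neg[OF l(1), of v] by (simp add: abs_le_iff)
  then show ?thesis
    using l(1) by (intro bounded_linear.intro bounded_linear_axioms.intro) blast+
qed

lemma convex_on_increment:
  fixes f :: "'a::real_vector \<Rightarrow> real"
  assumes "convex_on UNIV f"
  shows "convex_on UNIV (\<lambda>v. f (x + v) - f x)"
proof (rule convex_onI)
  fix t :: real and u v
  assume t: "0 < t" "t < 1"
  have "f ((1 - t) *\<^sub>R (x + u) + t *\<^sub>R (x + v)) \<le> (1 - t) * f (x + u) + t * f (x + v)"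
    using t by (intro convex_on_combination[OF assms]) auto
  moreover have "(1 - t) *\<^sub>R (x + u) + t *\<^sub>R (x + v) = x + ((1 - t) *\<^sub>R u + t *\<^sub>R v)"
    by (simp add: algebra_simps)
  ultimately show "f (x + ((1 - t) *\<^sub>R u + t *\<^sub>R v)) - f x
      \<le> (1 - t) * (f (x + u) - f x) + t * (f (x + v) - f x)"
    by (simp add: algebra_simps)
qed simp

lemma isCont_increment:
  fixes f :: "'a::real_normed_vector \<Rightarrow> real"
  assumes "continuous_on UNIV f"
  shows "isCont (\<lambda>v. f (x + v) - f x) 0"
proof -
  have "isCont f (x + 0)"
    using assms continuous_on_eq_continuous_at by blast
  then show ?thesis
    by (intro continuous_intros isCont_o2[where f = "\<lambda>v. x + v"]) auto
qed

lemma subdifferential_nonempty: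
  fixes f :: "'a::real_normed_vector \<Rightarrow> real"
  assumes "continuous_on UNIV f" "convex_on UNIV f"
  obtains \<xi> where "\<xi> \<in> subdifferential f x"
proof -
  obtain l where l: "linear l" "\<And>v. l v \<le> f (x + v) - f x"
    using linear_minorant[OF convex_on_increment[OF assms(2)], of x] by auto
  have "bounded_linear l"
    by (rule bounded_linear_minorant[OF l isCont_increment[OF assms(1)]]) simp
  then have "Blinfun l \<in> subdifferential f x"
    using l(2)[of "y - x" for y]
    by (simp add: subdifferential_def bounded_linear_Blinfun_apply)
  then show thesis by (rule that)
qed

text \<open>
This is the subdifferential sum rule at a minimiser, where the sum has 0 as a subgradient. The increments
of \<open>g\<close> and \<open>h\<close> at \<open>x\<close> have a nonnegative sum, so a linear function fits between the
one of \<open>g\<close> and the negative of the one of \<open>h\<close>; continuity of \<open>g\<close> makes it bounded.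
\<close>

lemma minimizer_of_sum_opposite_subgradients:
  fixes g h :: "'a::real_normed_vector \<Rightarrow> real"
  assumes g: "continuous_on UNIV g" "convex_on UNIV g"
    and h: "convex_on UNIV h"
    and min: "\<And>y. g x + h x \<le> g y + h y"
  obtains \<xi> where "\<xi> \<in> subdifferential g x" "- \<xi> \<in> subdifferential h x"
proof -
  obtain l where l: "linear l" "\<And>v. l v \<le> g (x + v) - g x" "\<And>v. - (h (x + v) - h x) \<le> l v"
  proof (rule linear_sandwich[OF convex_on_increment[OF g(2), of x] _
        convex_on_increment[OF h, of x]])
    show "0 \<le> g (x + v) - g x + (h (x + v) - h x)" for v
      using min[of "x + v"] by simp
  qed auto
  have "bounded_linear l"
    by (rule bounded_linear_minorant[OF l(1,2) isCont_increment[OF g(1)]]) simp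
  then have *: "blinfun_apply (Blinfun l) = l"
    by (rule bounded_linear_Blinfun_apply)
  have "l (y - x) \<le> g y - g x" "- l (y - x) \<le> h y - h x" for y
    using l(2)[of "y - x"] l(3)[of "y - x"] by simp_all
  then have "Blinfun l \<in> subdifferential g x" "- Blinfun l \<in> subdifferential h x"
    by (simp_all add: subdifferential_def * uminus_blinfun.rep_eq)
  then show thesis by (rule that)
qed

section \<open>Minimisers in reflexive spaces\<close>

text \<open>
The point \<open>x\<close> replaces the weak limit of a subsequence. The map that sends \<open>\<xi>\<close> to the upper limit of
\<open>\<xi> (y k)\<close> is sublinear on the dual space; a linear functional below it is bounded because \<open>y\<close> is, so
reflexivity represents it by a point.
\<close>

lemma reflexive_bounded_sequence:
  fixes y :: "nat \<Rightarrow> 'a::real_normed_vector"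
  assumes refl: "reflexive_space TYPE('a)" and "bounded (range y)"
  obtains x where "\<And>(\<xi> :: 'a \<Rightarrow>\<^sub>L real) n c. (\<And>k. n \<le> k \<Longrightarrow> \<xi> (y k) \<le> c) \<Longrightarrow> \<xi> x \<le> c"
proof -
  obtain R where R: "\<And>k. norm (y k) \<le> R"
    using assms(2) by (auto simp: bounded_iff)
  have bound: "\<bar>\<xi> (y k)\<bar> \<le> R * norm \<xi>" for \<xi> :: "'a \<Rightarrow>\<^sub>L real" and k
  proof -
    have "\<bar>\<xi> (y k)\<bar> \<le> norm \<xi> * norm (y k)" using norm_blinfun[of \<xi> "y k"] by simp
    also have "\<dots> \<le> norm \<xi> * R" using R by (intro mult_left_mono) auto
    finally show ?thesis by (simp add: mult.commute)
  qed
  define S :: "nat \<Rightarrow> ('a \<Rightarrow>\<^sub>L real) \<Rightarrow> real"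
    where "S n \<xi> = (SUP k\<in>{n..}. \<xi> (y k))" for n \<xi>
  have bddS: "bdd_above ((\<lambda>k. blinfun_apply \<xi> (y k)) ` {n..})" for n and \<xi> :: "'a \<Rightarrow>\<^sub>L real"
    by (rule bdd_aboveI[of _ "R * norm \<xi>"]) (use bound[of \<xi>] in \<open>auto simp: abs_le_iff\<close>)
  have S_upper: "blinfun_apply \<xi> (y k) \<le> S n \<xi>" if "n \<le> k" for n k \<xi>
    unfolding S_def using that by (intro cSUP_upper[OF _ bddS]) auto
  have S_least: "S n \<xi> \<le> c" if "\<And>k. n \<le> k \<Longrightarrow> blinfun_apply \<xi> (y k) \<le> c" for n c \<xi>
    unfolding S_def using that by (intro cSUP_least) auto
  let ?p = "\<lambda>\<xi>. INF n. S n \<xi>"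
  have "- (R * norm \<xi>) \<le> S n \<xi>" for n \<xi>
    using S_upper[OF order_refl, of \<xi> n] bound[of \<xi> n] by linarith
  then have bdd: "bdd_below (range (\<lambda>n. S n \<xi>))" for \<xi>
    by (auto simp: bdd_below_def)
  have "convex_on UNIV ?p"
  proof (rule convex_on_INF[OF _ bdd])
    fix m n :: nat and \<xi> \<eta> :: "'a \<Rightarrow>\<^sub>L real" and a b :: real
    assume ab: "0 \<le> a" "0 \<le> b" "a + b = 1"
    have "S (max m n) (a *\<^sub>R \<xi> + b *\<^sub>R \<eta>) \<le> a * S m \<xi> + b * S n \<eta>"
    proof (rule S_least)
      fix k assume "max m n \<le> k"
      then have "a * \<xi> (y k) + b * \<eta> (y k) \<le> a * S m \<xi> + b * S n \<eta>"
        using ab S_upper by (intro add_mono mult_left_mono) auto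
      then show "(a *\<^sub>R \<xi> + b *\<^sub>R \<eta>) (y k) \<le> a * S m \<xi> + b * S n \<eta>"
        by (simp add: plus_blinfun.rep_eq scaleR_blinfun.rep_eq)
    qed
    then show "\<exists>k\<in>UNIV. S k (a *\<^sub>R \<xi> + b *\<^sub>R \<eta>) \<le> a * S m \<xi> + b * S n \<eta>"
      by blast
  qed auto
  moreover have "?p 0 = 0"
    by (simp add: S_def)
  ultimately obtain l where l: "linear l" "\<And>\<xi>. l \<xi> \<le> ?p \<xi>"
    using linear_minorant[of ?p] by blast
  have le_S: "l \<xi> \<le> S n \<xi>" for n \<xi>
    using l(2)[of \<xi>] cINF_lower[OF bdd, of n \<xi>] by simp
  have "S 0 \<xi> \<le> norm \<xi> * R" for \<xi>
    using bound by (intro S_least) (auto simp: abs_le_iff mult.commute)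
  then have upper: "l \<xi> \<le> norm \<xi> * R" for \<xi>
    using le_S order_trans by blast
  have "norm (l \<xi>) \<le> norm \<xi> * R" for \<xi>
    using upper[of \<xi>] upper[of "- \<xi>"] linear_neg[OF l(1), of \<xi>] by (simp add: abs_le_iff)
  then have "bounded_linear l"
    using l(1) by (intro bounded_linear.intro bounded_linear_axioms.intro) blast+
  then have "blinfun_apply (Blinfun l) = l"
    by (rule bounded_linear_Blinfun_apply)
  then obtain x where x: "\<And>\<xi>. l \<xi> = blinfun_apply \<xi> x"
    using refl unfolding reflexive_space_def by metis
  show thesis
  proof (rule that)
    fix \<xi> :: "'a \<Rightarrow>\<^sub>L real" and n c
    assume "\<And>k. n \<le> k \<Longrightarrow> \<xi> (y k) \<le> c"
    then have "S n \<xi> \<le> c" by (rule S_least)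
    then show "\<xi> x \<le> c"
      using le_S[of \<xi> n] by (simp add: x)
  qed
qed

lemma U_function_bounded_below:
  assumes "U_function f"
  obtains M where "\<And>x. M \<le> f x"
proof -
  have "bounded (f ` {x. f x \<le> 0})"
    using assms by (auto simp: U_function_def coercive_def)
  then obtain B where B: "\<And>x. f x \<le> 0 \<Longrightarrow> \<bar>f x\<bar> \<le> B"
    by (auto simp: bounded_iff)
  have "min 0 (- B) \<le> f x" for x
    using B[of x] by (cases "f x \<le> 0") auto
  then show thesis by (rule that)
qed

text \<open>
A weak cluster point \<open>x\<close> of a minimising sequence is a minimiser: a subgradient at \<open>x\<close> bounds \<open>g\<close> from
below by an affine function, and along the sequence the linear part cannot stay below its value at \<open>x\<close>.
\<close>

theorem U_function_minimizer_exists: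
  fixes g :: "'a::real_normed_vector \<Rightarrow> real"
  assumes refl: "reflexive_space TYPE('a)" and U: "U_function g"
  obtains x where "\<And>y. g x \<le> g y"
proof -
  obtain M where "\<And>x. M \<le> g x"
    using U_function_bounded_below[OF U] by blast
  then have bdd: "bdd_below (range g)"
    by (auto simp: bdd_below_def)
  define m where "m = (INF x. g x)"
  have "\<exists>y. g y < m + 1 / real (Suc n)" for n
    using cINF_less_iff[OF _ bdd, of "m + 1 / real (Suc n)"] by (simp add: m_def)
  then obtain y where y: "\<And>n. g (y n) < m + 1 / real (Suc n)"
    by metis
  have tail: "g (y k) \<le> m + 1 / real (Suc n)" if "n \<le> k" for n k
  proof -
    have "1 / real (Suc k) \<le> 1 / real (Suc n)"
      using that by (intro divide_left_mono) auto
    then show ?thesis using y[of k] by linarith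
  qed
  have "range y \<subseteq> {x. g x \<le> m + 1}"
    using tail[of 0] by auto
  then have "bounded (range y)"
    using U by (auto simp: U_function_def coercive_def intro: bounded_subset)
  then obtain x where x: "\<And>(\<xi> :: 'a \<Rightarrow>\<^sub>L real) n c. (\<And>k. n \<le> k \<Longrightarrow> \<xi> (y k) \<le> c) \<Longrightarrow> \<xi> x \<le> c"
    using reflexive_bounded_sequence[OF refl] by blast
  obtain \<xi> where \<xi>: "\<xi> \<in> subdifferential g x"
    using subdifferential_nonempty U unfolding U_function_def by metis
  have "g x \<le> m + 1 / real (Suc n)" for n
  proof -
    have "\<xi> x \<le> \<xi> x + (m + 1 / real (Suc n) - g x)"
    proof (rule x)
      fix k assume "n \<le> k"
      have "\<xi> (y k) - \<xi> x \<le> g (y k) - g x"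
        using \<xi> by (simp add: subdifferential_def blinfun.diff_right)
      then show "\<xi> (y k) \<le> \<xi> x + (m + 1 / real (Suc n) - g x)"
        using tail[OF \<open>n \<le> k\<close>] by linarith
    qed
    then show ?thesis by simp
  qed
  moreover have "(\<lambda>n. m + 1 / real (Suc n)) \<longlonglongrightarrow> m + 0"
    by (intro tendsto_intros LIMSEQ_Suc[OF lim_1_over_n])
  ultimately have "g x \<le> m"
    using LIMSEQ_le_const[of _ m "g x"] by auto
  then show thesis
    using cINF_lower[OF bdd] that unfolding m_def by (meson UNIV_I order_trans)
qed

lemma strictly_convex_minimizer_unique:
  assumes "strictly_convex g" "\<And>y. g x \<le> g y" "g z \<le> g x"
  shows "z = x"
proof (rule ccontr)
  assume "z \<noteq> x"
  then have "g ((1/2) *\<^sub>R (z + x)) < (1/2) * (g z + g x)"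
    using assms(1) by (simp add: strictly_convex_def)
  with assms(2)[of "(1/2) *\<^sub>R (z + x)"] assms(3) show False by simp
qed

section \<open>Convex combinations of U-functions\<close>

definition mixture :: "('n::finite \<Rightarrow> 'a \<Rightarrow> real) \<Rightarrow> real ^ 'n \<Rightarrow> 'a \<Rightarrow> real" where
  "mixture f t x = (\<Sum>i\<in>UNIV. t $ i * f i x)"

lemma weight_simplexD:
  assumes "t \<in> weight_simplex"
  shows "0 \<le> t $ i" "t $ i \<le> 1" "(\<Sum>i\<in>UNIV. t $ i) = 1"
  using assms by (auto simp: weight_simplex_def)

lemma weight_simplex_positive_weight:
  assumes "t \<in> weight_simplex"
  obtains i where "0 < t $ i"
proof -
  have "\<exists>i. t $ i \<noteq> 0"
  proof (rule ccontr)
    assume "\<nexists>i. t $ i \<noteq> 0"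
    then show False using weight_simplexD(3)[OF assms] by simp
  qed
  then obtain i where "t $ i \<noteq> 0" by blast
  then show thesis
    using that[of i] weight_simplexD(1)[OF assms, of i] by simp
qed

text \<open>
A bound on a combination passes to each summand whose weight is at least \<open>c\<close>, since the other
summands cannot fall below \<open>M\<close>. The bound depends on the weights only through \<open>c\<close>; this
uniformity confines the minimisers for all weights near a given one to a common bounded set.
\<close>

lemma mixture_summand_bound:
  assumes t: "t \<in> weight_simplex" and i: "0 < c" "c \<le> t $ i"
    and M: "\<And>j. M \<le> f j x" and C: "mixture f t x \<le> C"
  shows "f i x \<le> M + (C - M) / c"
proof -
  have "c * (f i x - M) \<le> t $ i * (f i x - M)"
    using i M[of i] by (intro mult_right_mono) auto
  also have "\<dots> \<le> (\<Sum>j\<in>UNIV. t $ j * (f j x - M))"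
    using weight_simplexD[OF t] M
    by (intro member_le_sum) (auto intro!: mult_nonneg_nonneg)
  also have "\<dots> = mixture f t x - (\<Sum>j\<in>UNIV. t $ j) * M"
    by (simp add: mixture_def right_diff_distrib sum_subtractf sum_distrib_right)
  also have "\<dots> \<le> C - M"
    using C weight_simplexD(3)[OF t] by simp
  finally have "f i x - M \<le> (C - M) / c"
    using i(1) by (simp add: field_simps)
  then show ?thesis by simp
qed

lemma U_functions_common_lower_bound:
  fixes f :: "'n::finite \<Rightarrow> 'a::real_normed_vector \<Rightarrow> real"
  assumes "\<And>i. U_function (f i)"
  obtains M where "\<And>i x. M \<le> f i x"
proof -
  have "\<forall>i. \<exists>M. \<forall>x. M \<le> f i x"
    using U_function_bounded_below[OF assms] by metis
  then obtain L where L: "\<And>i x. L i \<le> f i x" by metis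
  have "Min (range L) \<le> f i x" for i x
    using order_trans[OF Min_le[of "range L" "L i"] L[of i x]] by simp
  then show thesis by (rule that)
qed

lemma convex_on_weighted_sum:
  assumes "finite I" "\<And>i. i \<in> I \<Longrightarrow> 0 \<le> c i" "\<And>i. i \<in> I \<Longrightarrow> convex_on UNIV (f i)"
  shows "convex_on UNIV (\<lambda>x. \<Sum>i\<in>I. c i * f i x :: real)"
  using assms
proof (induction I rule: finite_induct)
  case empty
  then show ?case by (simp add: convex_on_def)
next
  case (insert i I)
  have "convex_on UNIV (\<lambda>x. c i * f i x)"
    by (rule convex_on_cmul) (simp_all add: insert.prems)
  moreover have "convex_on UNIV (\<lambda>x. \<Sum>j\<in>I. c j * f j x)"
    by (rule insert.IH) (simp_all add: insert.prems)
  ultimately have "convex_on UNIV (\<lambda>x. c i * f i x + (\<Sum>j\<in>I. c j * f j x))"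
    by (rule convex_on_add)
  then show ?case using insert(1,2) by simp
qed

lemma U_function_mixture:
  fixes f :: "'n::finite \<Rightarrow> 'a::real_normed_vector \<Rightarrow> real"
  assumes U: "\<And>i. U_function (f i)" and t: "t \<in> weight_simplex"
  shows "U_function (mixture f t)"
proof -
  note t' = weight_simplexD[OF t]
  obtain i where i: "0 < t $ i"
    by (rule weight_simplex_positive_weight[OF t])
  obtain M where M: "\<And>i x. M \<le> f i x"
    using U_functions_common_lower_bound[of f, OF U] by metis
  have "continuous_on UNIV (mixture f t)"
    unfolding mixture_def using U by (intro continuous_intros) (auto simp: U_function_def)
  moreover have "convex_on UNIV (mixture f t)"
    unfolding mixture_def using U t'
    by (intro convex_on_weighted_sum[where f = f and c = "($) t"]) (auto simp: U_function_def)
  moreover have "strictly_convex (mixture f t)"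
    unfolding strictly_convex_def
  proof (intro allI impI)
    fix x y :: 'a
    assume "x \<noteq> y"
    then have strict: "f j ((1/2) *\<^sub>R (x + y)) < (1/2) * (f j x + f j y)" for j
      using U[of j] by (auto simp: U_function_def strictly_convex_def)
    have "mixture f t ((1/2) *\<^sub>R (x + y)) < (\<Sum>j\<in>UNIV. t $ j * ((1/2) * (f j x + f j y)))"
      unfolding mixture_def
    proof (rule sum_strict_mono_ex1)
      show "\<forall>j\<in>UNIV. t $ j * f j ((1/2) *\<^sub>R (x + y)) \<le> t $ j * ((1/2) * (f j x + f j y))"
        using mult_left_mono[OF less_imp_le[OF strict] t'(1)] by blast
      show "\<exists>j\<in>UNIV. t $ j * f j ((1/2) *\<^sub>R (x + y)) < t $ j * ((1/2) * (f j x + f j y))"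
        using i strict[of i] by (intro bexI[of _ i] mult_strict_left_mono) auto
    qed simp
    also have "\<dots> = (1/2) * (mixture f t x + mixture f t y)"
      by (simp add: mixture_def sum_distrib_left sum.distrib algebra_simps)
    finally show "mixture f t ((1/2) *\<^sub>R (x + y)) < (1/2) * (mixture f t x + mixture f t y)" .
  qed
  moreover have "bounded (mixture f t ` B)" if "bounded B" for B
  proof -
    have "\<forall>j. \<exists>C. \<forall>x\<in>B. \<bar>f j x\<bar> \<le> C"
      using U that by (auto simp: U_function_def bounded_iff)
    then obtain C where C: "\<And>j x. x \<in> B \<Longrightarrow> \<bar>f j x\<bar> \<le> C j" by metis
    have "\<bar>mixture f t x\<bar> \<le> (\<Sum>j\<in>UNIV. t $ j * C j)" if "x \<in> B" for x
    proof -
      have "\<bar>mixture f t x\<bar> \<le> (\<Sum>j\<in>UNIV. \<bar>t $ j * f j x\<bar>)"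
        unfolding mixture_def by (rule sum_abs)
      also have "\<dots> \<le> (\<Sum>j\<in>UNIV. t $ j * C j)"
        using C[OF that] t' by (intro sum_mono) (auto simp: abs_mult intro!: mult_left_mono)
      finally show ?thesis .
    qed
    then show ?thesis by (auto simp: bounded_iff)
  qed
  moreover have "coercive (mixture f t)"
    unfolding coercive_def
  proof
    fix C
    have "{x. mixture f t x \<le> C} \<subseteq> {x. f i x \<le> M + (C - M) / t $ i}"
      using mixture_summand_bound[where f = f, OF t i order_refl M] by blast
    moreover have "bounded {x. f i x \<le> M + (C - M) / t $ i}"
      using U[of i] by (simp add: U_function_def coercive_def)
    ultimately show "bounded {x. mixture f t x \<le> C}"
      by (rule bounded_subset[rotated])
  qed
  ultimately show ?thesis by (simp add: U_function_def)
qed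

lemma argmin_map_minimizes:
  fixes f :: "'n::finite \<Rightarrow> 'a::real_normed_vector \<Rightarrow> real"
  assumes "reflexive_space TYPE('a)" "\<And>i. U_function (f i)" "t \<in> weight_simplex"
  shows "mixture f t (argmin_map f t) \<le> mixture f t y"
proof -
  have "U_function (mixture f t)"
    by (rule U_function_mixture[where f = f, OF assms(2,3)])
  then obtain x where "\<And>y. mixture f t x \<le> mixture f t y"
    by (rule U_function_minimizer_exists[OF assms(1)]) blast
  then have "is_arg_min (mixture f t) (\<lambda>_. True) x"
    by (simp add: is_arg_min_linorder)
  then have "is_arg_min (mixture f t) (\<lambda>_. True) (arg_min (mixture f t) (\<lambda>_. True))"
    unfolding arg_min_def by (rule someI)
  moreover have "argmin_map f t = arg_min (mixture f t) (\<lambda>_. True)"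
    by (simp add: argmin_map_def mixture_def[abs_def])
  ultimately show ?thesis
    by (simp add: is_arg_min_linorder)
qed

section \<open>Continuity of the minimiser\<close>

text \<open>
Opposite subgradients \<open>\<xi>\<close> and \<open>- \<xi>\<close> of \<open>t $ i * f i\<close> and of the remaining sum cancel, so the excess
of \<open>f i\<close> over its affine support at \<open>x\<close> is at most \<open>1 / t $ i\<close> times the excess of the combination over its
minimum. Thus a minimising sequence satisfies the premise of the small diameter property.
\<close>

theorem minimizing_sequence_converges:
  fixes f :: "'n::finite \<Rightarrow> 'a::real_normed_vector \<Rightarrow> real"
  assumes U: "\<And>i. U_function (f i)" and t: "t \<in> weight_simplex"
    and SDP: "has_SDP (f i)" and i: "0 < t $ i"
    and min: "\<And>y. mixture f t x \<le> mixture f t y"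
    and s: "(\<lambda>n. mixture f t (s n)) \<longlonglongrightarrow> mixture f t x"
  shows "s \<longlonglongrightarrow> x"
proof -
  let ?g = "\<lambda>y. t $ i * f i y" and ?h = "\<lambda>y. \<Sum>j\<in>UNIV - {i}. t $ j * f j y"
  have split: "mixture f t y = ?g y + ?h y" for y
    unfolding mixture_def by (simp add: sum.remove[of UNIV i])
  have "continuous_on UNIV ?g" "convex_on UNIV ?g"
    using U[of i] i by (auto simp: U_function_def intro!: continuous_intros convex_on_cmul)
  moreover have "convex_on UNIV ?h"
    using U weight_simplexD[OF t] by (intro convex_on_weighted_sum[where f = f and c = "($) t"]) (auto simp: U_function_def)
  moreover have "?g x + ?h x \<le> ?g y + ?h y" for y
    using min[of y] by (simp add: split)
  ultimately obtain \<xi> where \<xi>: "\<xi> \<in> subdifferential ?g x" "- \<xi> \<in> subdifferential ?h x"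
    by (rule minimizer_of_sum_opposite_subgradients) blast
  define \<eta> where "\<eta> = (1 / t $ i) *\<^sub>R \<xi>"
  have \<eta>: "\<eta> \<in> subdifferential (f i) x"
    using \<xi>(1) i by (auto simp: subdifferential_def \<eta>_def scaleR_blinfun.rep_eq field_simps)
  have "(\<lambda>n. (\<eta> x - f i x) - (\<eta> (s n) - f i (s n))) \<longlonglongrightarrow> 0"
  proof (rule tendsto_sandwich)
    have "0 \<le> (\<eta> x - f i x) - (\<eta> y - f i y)" for y
    proof -
      have "\<eta> y - \<eta> x \<le> f i y - f i x"
        using \<eta> by (simp add: subdifferential_def blinfun.diff_right)
      then show ?thesis by linarith
    qed
    then show "\<forall>\<^sub>F n in sequentially. 0 \<le> (\<eta> x - f i x) - (\<eta> (s n) - f i (s n))"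
      by simp
    have "(\<eta> x - f i x) - (\<eta> y - f i y) \<le> (mixture f t y - mixture f t x) / t $ i" for y
    proof -
      have "- (\<xi> y - \<xi> x) \<le> ?h y - ?h x"
        using \<xi>(2) by (simp add: subdifferential_def blinfun.diff_right uminus_blinfun.rep_eq)
      then have "t $ i * ((\<eta> x - f i x) - (\<eta> y - f i y)) \<le> mixture f t y - mixture f t x"
        using i by (simp add: split \<eta>_def scaleR_blinfun.rep_eq algebra_simps)
      then show ?thesis using i by (simp add: field_simps)
    qed
    then show "\<forall>\<^sub>F n in sequentially. (\<eta> x - f i x) - (\<eta> (s n) - f i (s n))
        \<le> (mixture f t (s n) - mixture f t x) / t $ i"
      by simp
    have "(\<lambda>n. (mixture f t (s n) - mixture f t x) / t $ i)
        \<longlonglongrightarrow> (mixture f t x - mixture f t x) / t $ i"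
      using i by (intro tendsto_intros s) auto
    then show "(\<lambda>n. (mixture f t (s n) - mixture f t x) / t $ i) \<longlonglongrightarrow> 0"
      by simp
  qed simp
  then have "(\<lambda>n. \<eta> (s n) - f i (s n)) \<longlonglongrightarrow> \<eta> x - f i x"
    using tendsto_diff[OF tendsto_const[of "\<eta> x - f i x"]] by fastforce
  then have "convergent s"
    using SDP \<eta> unfolding has_SDP_def small_diameter_point_def by blast
  then obtain z where z: "s \<longlonglongrightarrow> z"
    by (auto simp: convergent_def)
  have U': "U_function (mixture f t)"
    by (rule U_function_mixture[where f = f, OF U t])
  then have "isCont (mixture f t) z"
    by (simp add: U_function_def continuous_on_eq_continuous_at)
  then have "mixture f t z = mixture f t x"
    using isCont_tendsto_compose[OF _ z] s LIMSEQ_unique by blast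
  then have "z = x"
    using U' min by (intro strictly_convex_minimizer_unique[where g = "mixture f t"]) (auto simp: U_function_def)
  with z show ?thesis by simp
qed

text \<open>
Comparing with the fixed competitor \<open>x\<close> bounds the minimal values uniformly, so the
minimisers \<open>s n\<close> eventually stay in a bounded set \<open>B\<close>, on which all the functions are bounded. Minimality of
\<open>s n\<close> for the weights \<open>\<tau> n\<close> then leaves an excess at the weights \<open>t\<close> that is controlled by
the differences of the weights.
\<close>

lemma argmin_map_minimizing:
  fixes f :: "'n::finite \<Rightarrow> 'a::real_normed_vector \<Rightarrow> real"
  assumes refl: "reflexive_space TYPE('a)" and U: "\<And>i. U_function (f i)"
    and t: "t \<in> weight_simplex"
    and \<tau>: "\<And>n. \<tau> n \<in> weight_simplex" "\<tau> \<longlonglongrightarrow> t"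
  shows "(\<lambda>n. mixture f t (argmin_map f (\<tau> n))) \<longlonglongrightarrow> mixture f t (argmin_map f t)"
proof -
  define x where "x = argmin_map f t"
  define s where "s n = argmin_map f (\<tau> n)" for n
  obtain i where i: "0 < t $ i"
    by (rule weight_simplex_positive_weight[OF t])
  have \<tau>_lim: "(\<lambda>n. \<tau> n $ j) \<longlonglongrightarrow> t $ j" for j
    by (intro tendsto_intros \<tau>)
  obtain M where M: "\<And>j y. M \<le> f j y"
    using U_functions_common_lower_bound[of f, OF U] by metis
  define K where "K = (\<Sum>j\<in>UNIV. \<bar>f j x\<bar>)"
  have le_K: "mixture f (\<tau> n) (s n) \<le> K" for n
  proof -
    have "mixture f (\<tau> n) (s n) \<le> mixture f (\<tau> n) x"
      unfolding s_def by (rule argmin_map_minimizes[where f = f, OF refl U \<tau>(1)])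
    also have "\<dots> \<le> K"
      unfolding mixture_def K_def
    proof (rule sum_mono)
      fix j
      have "\<tau> n $ j * f j x \<le> \<tau> n $ j * \<bar>f j x\<bar>"
        using weight_simplexD[OF \<tau>(1)] by (intro mult_left_mono) auto
      also have "\<dots> \<le> \<bar>f j x\<bar>"
        using weight_simplexD[OF \<tau>(1)] by (intro mult_left_le_one_le) auto
      finally show "\<tau> n $ j * f j x \<le> \<bar>f j x\<bar>" .
    qed
    finally show ?thesis .
  qed
  \<comment> \<open>Half the limit weight is a lower bound for the weights \<open>\<tau> n $ i\<close> from some index on.\<close>
  define B where "B = {y. f i y \<le> M + (K - M) / (t $ i / 2)}"
  have "\<forall>\<^sub>F n in sequentially. t $ i / 2 < \<tau> n $ i"
    using i by (intro order_tendstoD(1)[OF \<tau>_lim]) simp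
  then have ev_B: "\<forall>\<^sub>F n in sequentially. s n \<in> B"
  proof eventually_elim
    case (elim n)
    then show ?case
      using mixture_summand_bound[where f = f, OF \<tau>(1) _ less_imp_le[OF elim] M le_K] i by (simp add: B_def)
  qed
  have "bounded B"
    using U[of i] by (simp add: U_function_def coercive_def B_def)
  then have "\<forall>j. \<exists>C. \<forall>y\<in>B. \<bar>f j y\<bar> \<le> C"
    using U by (auto simp: U_function_def bounded_iff)
  then obtain C where C: "\<And>j y. y \<in> B \<Longrightarrow> \<bar>f j y\<bar> \<le> C j" by metis
  have "(\<lambda>n. mixture f t (s n) - mixture f t x) \<longlonglongrightarrow> 0"
  proof (rule tendsto_sandwich)
    show "\<forall>\<^sub>F n in sequentially. 0 \<le> mixture f t (s n) - mixture f t x"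
      using argmin_map_minimizes[where f = f, OF refl U t] by (simp add: x_def)
    show "\<forall>\<^sub>F n in sequentially. mixture f t (s n) - mixture f t x
        \<le> (\<Sum>j\<in>UNIV. \<bar>t $ j - \<tau> n $ j\<bar> * (C j + \<bar>f j x\<bar>))"
      using ev_B
    proof eventually_elim
      case (elim n)
      have "mixture f (\<tau> n) (s n) \<le> mixture f (\<tau> n) x"
        unfolding s_def by (rule argmin_map_minimizes[where f = f, OF refl U \<tau>(1)])
      then have "mixture f t (s n) - mixture f t x
          \<le> (mixture f t (s n) - mixture f t x) - (mixture f (\<tau> n) (s n) - mixture f (\<tau> n) x)"
        by simp
      also have "\<dots> = (\<Sum>j\<in>UNIV. (t $ j - \<tau> n $ j) * (f j (s n) - f j x))"
        by (simp add: mixture_def left_diff_distrib right_diff_distrib sum_subtractf)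
      also have "\<dots> \<le> (\<Sum>j\<in>UNIV. \<bar>t $ j - \<tau> n $ j\<bar> * (C j + \<bar>f j x\<bar>))"
      proof (rule sum_mono)
        fix j
        have "(t $ j - \<tau> n $ j) * (f j (s n) - f j x)
            \<le> \<bar>t $ j - \<tau> n $ j\<bar> * \<bar>f j (s n) - f j x\<bar>"
          by (metis abs_ge_self abs_mult)
        also have "\<dots> \<le> \<bar>t $ j - \<tau> n $ j\<bar> * (C j + \<bar>f j x\<bar>)"
          using C[OF elim, of j] by (intro mult_left_mono) auto
        finally show "(t $ j - \<tau> n $ j) * (f j (s n) - f j x)
            \<le> \<bar>t $ j - \<tau> n $ j\<bar> * (C j + \<bar>f j x\<bar>)" .
      qed
      finally show ?case .
    qed
    have "(\<lambda>n. \<Sum>j\<in>UNIV. \<bar>t $ j - \<tau> n $ j\<bar> * (C j + \<bar>f j x\<bar>))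
        \<longlonglongrightarrow> (\<Sum>j\<in>UNIV. \<bar>t $ j - t $ j\<bar> * (C j + \<bar>f j x\<bar>))"
      by (intro tendsto_intros \<tau>)
    then show "(\<lambda>n. \<Sum>j\<in>UNIV. \<bar>t $ j - \<tau> n $ j\<bar> * (C j + \<bar>f j x\<bar>)) \<longlonglongrightarrow> 0"
      by simp
  qed simp
  then show ?thesis
    by (simp add: LIM_zero_iff s_def x_def)
qed

theorem theorem3p5:
  fixes f :: "'n::finite \<Rightarrow> 'a::banach \<Rightarrow> real"
  assumes "reflexive_space TYPE('a)"
    and "\<And>i. U_function (f i)"
  shows "(\<forall>i. has_SDP (f i) \<longrightarrow>
            (\<forall>t \<in> {t \<in> weight_simplex. t $ i \<noteq> 0}.
               continuous (at t within weight_simplex) (argmin_map f)))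
       \<and> ((\<forall>i. has_SDP (f i)) \<longrightarrow> continuous_on weight_simplex (argmin_map f))"
proof -
  have cont: "continuous (at t within weight_simplex) (argmin_map f)"
    if "has_SDP (f i)" "t \<in> weight_simplex" "t $ i \<noteq> 0" for i t
  proof (rule continuous_within_sequentiallyI)
    fix \<tau> :: "nat \<Rightarrow> real ^ 'n"
    assume \<tau>: "\<tau> \<longlonglongrightarrow> t" "\<forall>n. \<tau> n \<in> weight_simplex"
    have "0 < t $ i"
      using that weight_simplexD(1)[of t i] by simp
    then show "(\<lambda>n. argmin_map f (\<tau> n)) \<longlonglongrightarrow> argmin_map f t"
      using that \<tau> assms
      by (intro minimizing_sequence_converges[of f t i] argmin_map_minimizing argmin_map_minimizes) auto
  qed
  moreover have "continuous_on weight_simplex (argmin_map f)" if "\<forall>i. has_SDP (f i)"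
    unfolding continuous_on_eq_continuous_within
  proof
    fix t :: "real ^ 'n"
    assume t: "t \<in> weight_simplex"
    then obtain i where "0 < t $ i"
      by (rule weight_simplex_positive_weight)
    then show "continuous (at t within weight_simplex) (argmin_map f)"
      using cont[of i t] that t by simp
  qed
  ultimately show ?thesis by blast
qed

end
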